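(* Consider the time-varying problem, regularized Lagrangian, feedback controllers and constants defined in the context, and let Assumptions 1--6 of the context hold. Let $\{z^k\}=\{(u^k,\gamma^k,\mu^k)\}_{k\ge 0}$ be a sequence generated by the controllers (S1)--(S3) of the context. For fixed scalars $\epsilon>0$, $\nu>0$, let $\eta=\min\{\nu,\epsilon\}$ and $L_{\nu,\epsilon}=\sqrt{(L+\nu+2G)^2+2(G+\epsilon)^2}$. If the stepsize $\alpha>0$ is chosen such that $$\rho(\alpha):=\sqrt{1-2\eta\alpha+\alpha^2L_{\nu,\epsilon}^2}<1,$$ that is, $0<\alpha<2\eta/L_{\nu,\epsilon}^2$, then the sequence $\{z^k\}$ converges Q-linearly to $z^{*,k}=(u^{*,k},\gamma^{*,k},\mu^{*,k})$ up to the asymptotic error bound $$\limsup_{k\to\infty}\|z^k-z^{*,k}\|_2\le\frac{1}{1-\rho(\alpha)}\big[\alpha e+\sigma_z\big],$$ where $e=\sqrt{e_u^2+2e_d^2}$ and $$e_u=\alpha\Big[\sum_{i\in\mathcal G}E_i^2X_i^2\big[K+\bar K+\epsilon(D_\gamma+D_\mu)+2e_d\big]^2\Big]^{1/2}.$$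
   Context: **Problem data.** Let $\mathcal N=\{1,\dots,N\}$ (nodes), $\mathcal G\subseteq\mathcal N$ with $N_{\mathcal G}=|\mathcal G|$ (nodes with distributed energy resources, DERs), $\mathcal M\subseteq\mathcal N$ with $M=|\mathcal M|$ (nodes where voltage is regulated). Time is indexed by $k\in\{0,1,2,\dots\}$. For each $i\in\mathcal G$ and each $k$, $\mathcal Y_i^k\subset\mathbb R^2$ is a (nonempty) convex compact set, and $u_i=(P_i,Q_i)\in\mathbb R^2$ is the setpoint of DER $i$. Write $u=(u_i)_{i\in\mathcal G}\in\mathbb R^{2N_{\mathcal G}}$ and $\mathcal Y^k=\prod_{i\in\mathcal G}\mathcal Y_i^k$. Given are real matrices $R^k=(r^k_{n,i})$, $B^k=(b^k_{n,i})\in\mathbb R^{N\times N}$, a vector $a^k\in\mathbb R^N$, loads $P_{\ell,i}^k,Q_{\ell,i}^k\in\mathbb R$ ($i\in\mathcal N$), limits $V^{\min},V^{\max}\in\mathbb R$, and cost functions $f_i^k:\mathbb R^2\to\mathbb R$ ($i\in\mathcal G$). Let $c_n^k=a_n^k-\sum_{i\in\mathcal N\setminus\mathcal G}(r_{n,i}^kP_{\ell,i}^k+b_{n,i}^kQ_{\ell,i}^k)$ and, for $n\in\mathcal M$, $$g_n^k(u)=V^{\min}-c_n^k-\sum_{i\in\mathcal G}[r_{n,i}^k(P_i-P_{\ell,i}^k)+b_{n,i}^k(Q_i-Q_{\ell,i}^k)],$$ $$\bar g_n^k(u)=\sum_{i\in\mathcal G}[r_{n,i}^k(P_i-P_{\ell,i}^k)+b_{n,i}^k(Q_i-Q_{\ell,i}^k)]+c_n^k-V^{\max}.$$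 Let $g^k,\bar g^k:\mathbb R^{2N_{\mathcal G}}\to\mathbb R^M$ stack these functions. The target problem at time $k$ is to minimize $\sum_{i\in\mathcal G}f_i^k(u_i)$ over $u\in\mathcal Y^k$ subject to $g^k(u)\le 0$, $\bar g^k(u)\le0$. **Regularized Lagrangian.** With multipliers $\gamma,\mu\in\mathbb R^M$ (entries indexed by $n\in\mathcal M$) and parameters $\nu,\epsilon>0$, $$\mathcal L^k_{\nu,\epsilon}(u,\gamma,\mu)=\sum_{i\in\mathcal G}f_i^k(u_i)+\gamma^{T}g^k(u)+\mu^{T}\bar g^k(u)+\frac\nu2\sum_{i\in\mathcal G}\|u_i\|_2^2-\frac\epsilon2(\|\gamma\|_2^2+\|\mu\|_2^2).$$ Let $z^{*,k}=(u^{*,k},\gamma^{*,k},\mu^{*,k})$ be the unique saddle point of $\max_{\gamma\in\mathbb R^M_+,\,\mu\in\mathbb R^M_+}\min_{u\in\mathcal Y^k}\mathcal L^k_{\nu,\epsilon}(u,\gamma,\mu)$. **Controllers.** $\mathrm{proj}$ denotes Euclidean projection, $\alpha>0$ is the stepsize, and $\mathcal D_\gamma,\mathcal D_\mu\subset\mathbb R_+$ are compact convex sets chosen to contain all entries of $\gamma^{*,k}$ and of $\mu^{*,k}$, respectively, for all $k$. Let $m_n^k\in\mathbb R$ be the voltage-magnitude measurement at node $n\in\mathcal M$ at time $k$. For each DER $i$, $\ell_i(k)\in\{0,\dots,k\}$ is the index of the most recent successful communication of the dual variables to DER $i$, so that the copies available at DER $i$ at time $k$ are $\gamma^{\ell_i(k)},\mu^{\ell_i(k)}$.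 Starting from $u^0\in\mathcal Y^0$ and $\gamma^0,\mu^0$ with entries in $\mathcal D_\gamma,\mathcal D_\mu$, for $k\ge0$: (S1) $u_i^{k+1}=\mathrm{proj}_{\mathcal Y_i^k}\{u_i^k-\alpha\nabla_{u_i}\mathcal L^k_{\nu,\epsilon}(u^k,\gamma^{\ell_i(k)},\mu^{\ell_i(k)})\}$ for all $i\in\mathcal G$; (S2) $\gamma_n^{k+1}=\mathrm{proj}_{\mathcal D_\gamma}\{\gamma_n^k+\alpha(V^{\min}-m_n^k-\epsilon\gamma_n^k)\}$ and $\mu_n^{k+1}=\mathrm{proj}_{\mathcal D_\mu}\{\mu_n^k+\alpha(m_n^k-V^{\max}-\epsilon\mu_n^k)\}$ for all $n\in\mathcal M$, and the dual variables are broadcast; (S3) each DER replaces its copies by the newest dual variables if they are received, and otherwise keeps its previous copies. **Assumptions.** 1. Each $f_i^k$ is convex and continuously differentiable, and the map $u\mapsto(\nabla f_i^k(u_i))_{i\in\mathcal G}$ is Lipschitz continuous with constant $L$ over $\mathcal Y^k$, for all $k\ge0$. 2. For all $k\ge0$ there is $\hat u\in\mathcal Y^k$ with $g_n^k(\hat u)\le0$ and $\bar g_n^k(\hat u)\le0$ for all $n\in\mathcal M$. 3. There is $\sigma_u\ge0$ with $\|u^{*,k+1}-u^{*,k}\|\le\sigma_u$ for all $k\ge0$. 4. There are $\sigma_d,\sigma_{\bar d}\ge0$ with $|g_n^{k+1}(u^{*,k+1})-g_n^k(u^{*,k})|\le\sigma_d$ and $|\bar g_n^{k+1}(u^{*,k+1})-\bar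 g_n^k(u^{*,k})|\le\sigma_{\bar d}$ for all $n\in\mathcal M$, $k\ge0$. 5. Let $e_\gamma^k,e_\mu^k\in\mathbb R^M$ have entries $V^{\min}-m_n^k-\epsilon\gamma_n^k-\partial_{\gamma_n}\mathcal L^k_{\nu,\epsilon}(u^k,\gamma^k,\mu^k)$ and $m_n^k-V^{\max}-\epsilon\mu_n^k-\partial_{\mu_n}\mathcal L^k_{\nu,\epsilon}(u^k,\gamma^k,\mu^k)$, respectively. There is $e_d\ge0$ with $\max\{\|e_\gamma^k\|_2,\|e_\mu^k\|_2\}\le e_d$ for all $k\ge0$. 6. For each DER $i\in\mathcal G$ there is $E_i<\infty$ with $k-\ell_i(k)\le E_i$ for all $k$ (at most $E_i$ consecutive communication packets are lost). **Constants.** $G$ satisfies $\|\nabla_ug^k(u)\|_2\le G$ and $\|\nabla_u\bar g^k(u)\|_2\le G$ for all $k$. $K,\bar K$ satisfy $\|g^k(u)\|_2\le K$ and $\|\bar g^k(u)\|_2\le\bar K$ for all $k\ge0$ and all $u\in\bigcup_{j\ge0}\mathcal Y^j$. $D_\gamma,D_\mu>0$ are such that every vector in $\mathbb R^M$ with all entries in $\mathcal D_\gamma$ (resp. $\mathcal D_\mu$) has Euclidean norm at most $D_\gamma$ (resp. $D_\mu$). $X_i$ satisfies $\|\xi_i^k\|_2\le X_i$ for all $k$, where $\xi_i^k\in\mathbb R^{2\times M}$ is the matrix with rows $(r_{n,i}^k)_{n\in\mathcal M}$ and $(b_{n,i}^k)_{n\in\mathcal M}$ (spectral norm). $\sigma_z\ge0$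 is a constant with $\|z^{*,k+1}-z^{*,k}\|_2\le\sigma_z$ for all $k\ge0$ (such a constant exists by Assumptions 3 and 4). **Terminology.** "Converges Q-linearly up to an asymptotic error bound $\beta$" means that $d_k=\|z^k-z^{*,k}\|_2$ satisfies $d_{k+1}\le c\,d_k+b$ for all $k$, for some $c\in[0,1)$ and $b\ge0$ with $b/(1-c)=\beta$.
   Formalization: Assumption 1 is strengthened: the stacked gradient of the time-k costs is L-Lipschitz over the union of Y^k and Y^{k-1} (just Y^0 at k=0), since u^k lies in Y^{k-1}; with Y^k alone the claim fails. *)

theory Defs
  imports "HOL-Analysis.Analysis"
begin

(* Nodes are the elements of the finite type 'n; a setpoint (P, Q) is a vector v :: real^2 with
   P = v $ 1 and Q = v $ 2. The node sets G and M may be arbitrary (also empty) subsets, so a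
   vector of R^(2 N_G) or of R^M is encoded as a vector over all nodes whose entries outside
   G or M are 0. This embedding is isometric, so the library's Euclidean and operator norms
   are those of R^(2 N_G) and R^M. *)
record ('n::finite) grid =
  ders :: "'n set"                                   (* G *)
  mons :: "'n set"                                   (* M *)
  opset :: "nat \<Rightarrow> 'n \<Rightarrow> (real^2) set"               (* Y_i^k *)
  cost :: "nat \<Rightarrow> 'n \<Rightarrow> real^2 \<Rightarrow> real"               (* f_i^k *)
  rmat :: "nat \<Rightarrow> real^'n^'n"                         (* R^k, entry r_{n,i} = rmat k $ n $ i *)
  bmat :: "nat \<Rightarrow> real^'n^'n"                         (* B^k *)
  avec :: "nat \<Rightarrow> real^'n"                            (* a^k *)
  pload :: "nat \<Rightarrow> real^'n"
  qload :: "nat \<Rightarrow> real^'n"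
  vmin :: real
  vmax :: real

definition grad :: "('a::real_inner \<Rightarrow> real) \<Rightarrow> 'a \<Rightarrow> 'a" where
  "grad F x = (THE d. GDERIV F x :> d)"

definition vec_upd :: "'a^'n \<Rightarrow> 'n \<Rightarrow> 'a \<Rightarrow> 'a^('n::finite)" where
  "vec_upd x i v = (\<chi> j. if j = i then v else x $ j)"

definition primal_set :: "('n::finite) grid \<Rightarrow> nat \<Rightarrow> ((real^2)^'n) set" where
  "primal_set D k =
     {u. (\<forall>i\<in>ders D. u $ i \<in> opset D k i) \<and> (\<forall>i. i \<notin> ders D \<longrightarrow> u $ i = 0)}"

(* The controllers project u^(k+1) onto Y^k, so u^k lies in Y^(k-1) whereas the saddle point at
   time k lies in Y^k; the gradients of the time-k costs are compared between these two points,
   and a Lipschitz bound on Y^k alone does not relate them (the tracking bound then fails).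
   For k = 0 the truncated subtraction gives just Y^0, where u^0 lies. *)
definition lipschitz_dom :: "('n::finite) grid \<Rightarrow> nat \<Rightarrow> ((real^2)^'n) set" where
  "lipschitz_dom D k = primal_set D k \<union> primal_set D (k - 1)"

(* The vectors of R^M with all entries in S. *)
definition dual_set :: "('n::finite) grid \<Rightarrow> real set \<Rightarrow> (real^'n) set" where
  "dual_set D S = {y. (\<forall>n\<in>mons D. y $ n \<in> S) \<and> (\<forall>n. n \<notin> mons D \<longrightarrow> y $ n = 0)}"

definition cconst :: "('n::finite) grid \<Rightarrow> nat \<Rightarrow> 'n \<Rightarrow> real" where
  "cconst D k n = avec D k $ n
     - (\<Sum>i\<in>UNIV - ders D. rmat D k $ n $ i * pload D k $ i + bmat D k $ n $ i * qload D k $ i)"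

definition der_term :: "('n::finite) grid \<Rightarrow> nat \<Rightarrow> 'n \<Rightarrow> (real^2)^'n \<Rightarrow> real" where
  "der_term D k n u =
     (\<Sum>i\<in>ders D. rmat D k $ n $ i * (u $ i $ 1 - pload D k $ i)
                + bmat D k $ n $ i * (u $ i $ 2 - qload D k $ i))"

(* The stacked constraint functions g^k (lower voltage limit) and gbar^k (upper limit). *)
definition g_low :: "('n::finite) grid \<Rightarrow> nat \<Rightarrow> (real^2)^'n \<Rightarrow> real^'n" where
  "g_low D k u = (\<chi> n. if n \<in> mons D then vmin D - cconst D k n - der_term D k n u else 0)"

definition g_up :: "('n::finite) grid \<Rightarrow> nat \<Rightarrow> (real^2)^'n \<Rightarrow> real^'n" where
  "g_up D k u = (\<chi> n. if n \<in> mons D then der_term D k n u + cconst D k n - vmax D else 0)"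

definition lagr ::
  "('n::finite) grid \<Rightarrow> real \<Rightarrow> real \<Rightarrow> nat \<Rightarrow> (real^2)^'n \<Rightarrow> real^'n \<Rightarrow> real^'n \<Rightarrow> real" where
  "lagr D \<nu> \<epsilon> k u \<gamma> \<mu> =
     (\<Sum>i\<in>ders D. cost D k i (u $ i)) + \<gamma> \<bullet> g_low D k u + \<mu> \<bullet> g_up D k u
     + \<nu> / 2 * (\<Sum>i\<in>ders D. (norm (u $ i))\<^sup>2)
     - \<epsilon> / 2 * ((norm \<gamma>)\<^sup>2 + (norm \<mu>)\<^sup>2)"

definition grad_u ::
  "('n::finite) grid \<Rightarrow> real \<Rightarrow> real \<Rightarrow> nat \<Rightarrow> 'n \<Rightarrow> (real^2)^'n \<Rightarrow> real^'n \<Rightarrow> real^'n \<Rightarrow> real^2" where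
  "grad_u D \<nu> \<epsilon> k i u \<gamma> \<mu> = grad (\<lambda>v. lagr D \<nu> \<epsilon> k (vec_upd u i v) \<gamma> \<mu>) (u $ i)"

definition is_saddle_point ::
  "('n::finite) grid \<Rightarrow> real \<Rightarrow> real \<Rightarrow> nat \<Rightarrow> ((real^2)^'n) \<times> (real^'n) \<times> (real^'n) \<Rightarrow> bool" where
  "is_saddle_point D \<nu> \<epsilon> k z \<longleftrightarrow> (case z of (us, \<gamma>s, \<mu>s) \<Rightarrow>
     us \<in> primal_set D k \<and> \<gamma>s \<in> dual_set D {0..} \<and> \<mu>s \<in> dual_set D {0..} \<and>
     (\<forall>u\<in>primal_set D k. lagr D \<nu> \<epsilon> k us \<gamma>s \<mu>s \<le> lagr D \<nu> \<epsilon> k u \<gamma>s \<mu>s) \<and>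
     (\<forall>\<gamma>\<in>dual_set D {0..}. \<forall>\<mu>\<in>dual_set D {0..}.
        lagr D \<nu> \<epsilon> k us \<gamma> \<mu> \<le> lagr D \<nu> \<epsilon> k us \<gamma>s \<mu>s))"

(* ell i k is the index of the newest dual variables held by DER i at time k; the last
   conjunct is the update rule for the copies: a broadcast is received or it is not. *)
definition controller_run ::
  "('n::finite) grid \<Rightarrow> real \<Rightarrow> real \<Rightarrow> real \<Rightarrow> real set \<Rightarrow> real set \<Rightarrow> (nat \<Rightarrow> real^'n) \<Rightarrow>
   ('n \<Rightarrow> nat \<Rightarrow> nat) \<Rightarrow> (nat \<Rightarrow> (real^2)^'n) \<Rightarrow> (nat \<Rightarrow> real^'n) \<Rightarrow> (nat \<Rightarrow> real^'n) \<Rightarrow> bool" where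
  "controller_run D \<nu> \<epsilon> \<alpha> S\<gamma> S\<mu> m ell u \<gamma> \<mu> \<longleftrightarrow>
     u 0 \<in> primal_set D 0 \<and> \<gamma> 0 \<in> dual_set D S\<gamma> \<and> \<mu> 0 \<in> dual_set D S\<mu> \<and>
     (\<forall>k. u (Suc k) = (\<chi> i. if i \<in> ders D
        then closest_point (opset D k i)
               (u k $ i - \<alpha> *\<^sub>R grad_u D \<nu> \<epsilon> k i (u k) (\<gamma> (ell i k)) (\<mu> (ell i k)))
        else 0)) \<and>
     (\<forall>k. \<gamma> (Suc k) = (\<chi> n. if n \<in> mons D
        then closest_point S\<gamma> (\<gamma> k $ n + \<alpha> * (vmin D - m k $ n - \<epsilon> * \<gamma> k $ n)) else 0)) \<and>
     (\<forall>k. \<mu> (Suc k) = (\<chi> n. if n \<in> mons D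
        then closest_point S\<mu> (\<mu> k $ n + \<alpha> * (m k $ n - vmax D - \<epsilon> * \<mu> k $ n)) else 0)) \<and>
     (\<forall>i\<in>ders D. \<forall>k. ell i k \<le> k) \<and>
     (\<forall>i\<in>ders D. \<forall>k. ell i (Suc k) = Suc k \<or> ell i (Suc k) = ell i k)"

(* The discrepancies between the measured and the model-based dual gradients. *)
definition err_gamma ::
  "('n::finite) grid \<Rightarrow> real \<Rightarrow> real \<Rightarrow> nat \<Rightarrow> real^'n \<Rightarrow>
   (real^2)^'n \<Rightarrow> real^'n \<Rightarrow> real^'n \<Rightarrow> real^'n" where
  "err_gamma D \<nu> \<epsilon> k mk u \<gamma> \<mu> = (\<chi> n. if n \<in> mons D
     then vmin D - mk $ n - \<epsilon> * \<gamma> $ n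
          - deriv (\<lambda>x. lagr D \<nu> \<epsilon> k u (vec_upd \<gamma> n x) \<mu>) (\<gamma> $ n)
     else 0)"

definition err_mu ::
  "('n::finite) grid \<Rightarrow> real \<Rightarrow> real \<Rightarrow> nat \<Rightarrow> real^'n \<Rightarrow>
   (real^2)^'n \<Rightarrow> real^'n \<Rightarrow> real^'n \<Rightarrow> real^'n" where
  "err_mu D \<nu> \<epsilon> k mk u \<gamma> \<mu> = (\<chi> n. if n \<in> mons D
     then mk $ n - vmax D - \<epsilon> * \<mu> $ n
          - deriv (\<lambda>x. lagr D \<nu> \<epsilon> k u \<gamma> (vec_upd \<mu> n x)) (\<mu> $ n)
     else 0)"

(* The 2 x M matrix with rows (r_{n,i})_n and (b_{n,i})_n. *)
definition xi_mat :: "('n::finite) grid \<Rightarrow> nat \<Rightarrow> 'n \<Rightarrow> real^'n^2" where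
  "xi_mat D k i = (\<chi> p n. if n \<in> mons D
     then (if p = 1 then rmat D k $ n $ i else bmat D k $ n $ i) else 0)"

definition q_linear_upto :: "(nat \<Rightarrow> real) \<Rightarrow> real \<Rightarrow> bool" where
  "q_linear_upto d \<beta> \<longleftrightarrow>
     (\<exists>c b. 0 \<le> c \<and> c < 1 \<and> 0 \<le> b \<and> b / (1 - c) = \<beta> \<and> (\<forall>k. d (Suc k) \<le> c * d k + b))"

end

theory Submission
  imports Defs
begin

text \<open>
  Why the theorem holds. At time \<open>k\<close> the saddle point of the regularized Lagrangian is the solution of
  the variational inequality on \<open>Y\<close> times the dual orthants for the operator

    \<open>\<Phi> (u, \<gamma>, \<mu>) = (\<nabla>\<^sub>u L, - \<nabla>\<^sub>\<gamma> L, - \<nabla>\<^sub>\<mu> L)\<close>.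

  The constraint functions are affine with linear parts \<open>-A\<close> and \<open>A\<close>, so \<open>\<Phi>\<close> is the gradient of a
  convex function, plus the skew part formed by \<open>A\<close> and its adjoint, plus the regularization
  \<open>(\<nu> u, \<epsilon> \<gamma>, \<epsilon> \<mu>)\<close>. The skew part drops out of inner products, hence \<open>\<Phi>\<close> is strongly monotone with
  constant \<open>min \<nu> \<epsilon>\<close> (\<open>saddle_op_strongly_monotone\<close>); bounding the three blocks gives the Lipschitz
  constant of the theorem (\<open>saddle_op_lipschitz\<close>). For such an operator the exact step \<open>z - \<alpha> \<Phi> z\<close>
  contracts distances by \<open>\<rho>\<close> (\<open>forward_step_contraction\<close>).

  The controllers perform this step up to an additive error \<open>\<alpha> w\<close>, followed by projections. The dual
  blocks of \<open>w\<close> are the measurement errors. The primal block comes from the outdated multipliers: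
  \<open>\<nabla>\<^sub>u L\<close> depends on them only through the adjoint of \<open>A\<close> applied to \<open>\<mu> - \<gamma>\<close>, and the multipliers move
  by at most \<open>\<alpha>\<close> times the norm of the measured dual gradient per step, over at most \<open>E i\<close> steps
  (\<open>delayed_dual_gradient_error\<close>). Together \<open>w\<close> has norm at most \<open>e\<close>. The projections do not increase
  the distance to the saddle point, by its variational inequality
  (\<open>projected_step_towards_saddle_point\<close>). Moving from the saddle point at time \<open>k\<close> to the next one
  costs at most \<open>\<sigma>\<^sub>z\<close>, so the tracking error obeys \<open>d (k + 1) \<le> \<rho> d k + \<alpha> e + \<sigma>\<^sub>z\<close>, and iterating this
  affine recursion gives the limit superior (\<open>limsup_affine_recursion_le\<close>).
\<close>

section \<open>Projected gradient steps in Euclidean spaces\<close>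

lemma grad_eqI:
  assumes "GDERIV F x :> d"
  shows "grad F x = d"
proof -
  have "d' = d" if "GDERIV F x :> d'" for d'
  proof -
    have "(\<lambda>h. h \<bullet> d') = (\<lambda>h. h \<bullet> d)"
      using that assms unfolding gderiv_def by (rule has_derivative_unique)
    from fun_cong[OF this, of "d' - d"] have "(d' - d) \<bullet> (d' - d) = 0" by (simp add: inner_diff_right)
    then show ?thesis by simp
  qed
  with assms show ?thesis unfolding grad_def by (intro the_equality)
qed

lemma GDERIV_grad:
  fixes F :: "'a::euclidean_space \<Rightarrow> real"
  assumes "F differentiable (at x)"
  shows "GDERIV F x :> grad F x"
proof -
  obtain F' where F': "(F has_derivative F') (at x)"
    using assms unfolding differentiable_def by blast
  interpret bounded_linear F' using F' by (rule has_derivative_bounded_linear)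
  define d where "d = (\<Sum>b\<in>Basis. F' b *\<^sub>R b)"
  have "F' h = h \<bullet> d" for h
  proof -
    have "F' h = F' (\<Sum>b\<in>Basis. (h \<bullet> b) *\<^sub>R b)" by (simp add: euclidean_representation)
    also have "\<dots> = (\<Sum>b\<in>Basis. (h \<bullet> b) * F' b)" by (simp add: sum scaleR)
    also have "\<dots> = h \<bullet> d" by (simp add: d_def inner_sum_right mult.commute)
    finally show ?thesis .
  qed
  then have "F' = (\<lambda>h. h \<bullet> d)" by (rule ext)
  then have "GDERIV F x :> d" using F' unfolding gderiv_def by simp
  then show ?thesis using grad_eqI[of F x d] by simp
qed

lemma GDERIV_along_line:
  assumes "GDERIV F x :> d"
  shows "((\<lambda>t. F (x + t *\<^sub>R v)) has_real_derivative d \<bullet> v) (at 0)"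
proof -
  have "((\<lambda>t. F (x + t *\<^sub>R v)) has_derivative (\<lambda>t. (t *\<^sub>R v) \<bullet> d)) (at 0)"
    by (rule has_derivative_compose[where g = F and f = "\<lambda>t. x + t *\<^sub>R v"])
      (use assms in \<open>auto simp: gderiv_def intro!: derivative_eq_intros\<close>)
  then show ?thesis
    by (simp add: has_field_derivative_def inner_commute mult_commute_abs)
qed

text \<open>
  Otherwise \<open>F\<close> would decrease along the segment from \<open>x\<close> towards \<open>y\<close>, which stays in \<open>S\<close>.
\<close>

lemma minimum_on_convex_imp_variational:
  assumes "convex S" and xS: "x \<in> S" and yS: "y \<in> S"
    and d: "GDERIV F x :> d" and min: "\<And>y. y \<in> S \<Longrightarrow> F x \<le> F y"
  shows "0 \<le> d \<bullet> (y - x)"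
proof (rule ccontr)
  assume "\<not> 0 \<le> d \<bullet> (y - x)"
  then obtain r where "r > 0"
    and r: "\<And>h. 0 < h \<Longrightarrow> h < r \<Longrightarrow> F (x + h *\<^sub>R (y - x)) < F x"
    using DERIV_neg_dec_right[OF GDERIV_along_line[OF d, of "y - x"]] by auto
  define h where "h = min (r / 2) 1"
  have h: "0 < h" "h < r" "h \<le> 1" using \<open>r > 0\<close> by (auto simp: h_def)
  have "x + h *\<^sub>R (y - x) = (1 - h) *\<^sub>R x + h *\<^sub>R y" by (simp add: algebra_simps)
  also have "\<dots> \<in> S" using assms(1) xS yS h by (simp add: convex_alt)
  finally show False using min r[OF h(1,2)] by fastforce
qed

text \<open>
  A convex function lies above its tangents; the tangent inequalities at \<open>x\<close> and at \<open>y\<close> are added up.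
\<close>

lemma convex_gradient_monotone:
  assumes cv: "convex_on UNIV F" and dx: "GDERIV F x :> dx" and dy: "GDERIV F y :> dy"
  shows "0 \<le> (x - y) \<bullet> (dx - dy)"
proof -
  (* Restricting F to the line through w and z reduces this to the tangent inequality in one variable. *)
  have tangent: "d \<bullet> (z - w) \<le> F z - F w" if d: "GDERIV F w :> d" for w z d
  proof -
    define \<phi> where "\<phi> = (\<lambda>t. F (w + t *\<^sub>R (z - w)))"
    have "convex_on UNIV \<phi>"
    proof (rule convex_onI)
      fix t a b :: real assume t: "0 < t" "t < 1"
      have "w + ((1 - t) *\<^sub>R a + t *\<^sub>R b) *\<^sub>R (z - w)
          = (1 - t) *\<^sub>R (w + a *\<^sub>R (z - w)) + t *\<^sub>R (w + b *\<^sub>R (z - w))"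
        by (simp add: algebra_simps)
      then show "\<phi> ((1 - t) *\<^sub>R a + t *\<^sub>R b) \<le> (1 - t) * \<phi> a + t * \<phi> b"
        unfolding \<phi>_def using convex_onD[OF cv, of t] t by simp
    qed simp
    from convex_on_imp_above_tangent[OF this, of 0 1 "d \<bullet> (z - w)"]
    show ?thesis using GDERIV_along_line[OF d, of "z - w"] by (simp add: \<phi>_def)
  qed
  from tangent[OF dx, of y] tangent[OF dy, of x] show ?thesis
    by (simp add: inner_diff_left inner_diff_right inner_commute)
qed

text \<open>
  Here \<open>x\<close> stands for the difference of two points and \<open>y\<close> for the difference of the values of an
  \<open>\<eta>\<close>-strongly monotone, \<open>l\<close>-Lipschitz operator; the bound comes from expanding the square.
\<close>

lemma forward_step_contraction:
  fixes x y :: "'a::real_inner"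
  assumes mono: "\<eta> * (norm x)\<^sup>2 \<le> x \<bullet> y" and lip: "norm y \<le> l * norm x" and "0 \<le> \<alpha>"
  shows "norm (x - \<alpha> *\<^sub>R y) \<le> sqrt (1 - 2 * \<eta> * \<alpha> + \<alpha>\<^sup>2 * l\<^sup>2) * norm x"
proof -
  have "(norm (x - \<alpha> *\<^sub>R y))\<^sup>2 = (norm x)\<^sup>2 - 2 * \<alpha> * (x \<bullet> y) + \<alpha>\<^sup>2 * (norm y)\<^sup>2"
    unfolding power2_norm_eq_inner
    by (simp add: inner_diff_left inner_diff_right inner_commute power2_eq_square algebra_simps)
  also have "\<dots> \<le> (norm x)\<^sup>2 - 2 * \<alpha> * (\<eta> * (norm x)\<^sup>2) + \<alpha>\<^sup>2 * (l * norm x)\<^sup>2"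
  proof -
    have "\<alpha> * (\<eta> * (norm x)\<^sup>2) \<le> \<alpha> * (x \<bullet> y)" using assms by (intro mult_left_mono) auto
    moreover have "\<alpha>\<^sup>2 * (norm y)\<^sup>2 \<le> \<alpha>\<^sup>2 * (l * norm x)\<^sup>2"
      by (intro mult_left_mono power_mono lip) auto
    ultimately show ?thesis by linarith
  qed
  also have "\<dots> = (1 - 2 * \<eta> * \<alpha> + \<alpha>\<^sup>2 * l\<^sup>2) * (norm x)\<^sup>2" by (simp add: algebra_simps power_mult_distrib)
  finally have "sqrt ((norm (x - \<alpha> *\<^sub>R y))\<^sup>2) \<le> sqrt ((1 - 2 * \<eta> * \<alpha> + \<alpha>\<^sup>2 * l\<^sup>2) * (norm x)\<^sup>2)"
    by (rule real_sqrt_le_mono)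
  then show ?thesis by (simp add: real_sqrt_mult)
qed

text \<open>
  A solution \<open>x\<close> of the variational inequality is the projection of \<open>x - \<alpha> d\<close>, so this is
  nonexpansiveness of the projection. It is obtained directly, by adding the variational inequality
  at the projected point to the obtuse-angle property of the projection.
\<close>

lemma projected_step_towards_variational_solution:
  fixes S :: "'a::euclidean_space set"
  assumes S: "convex S" "closed S" and xS: "x \<in> S" and "0 \<le> \<alpha>"
    and vi: "\<And>y. y \<in> S \<Longrightarrow> 0 \<le> d \<bullet> (y - x)"
  shows "norm (closest_point S a - x) \<le> norm (a - (x - \<alpha> *\<^sub>R d))"
proof -
  define p where "p = closest_point S a"
  have "p \<in> S" unfolding p_def using S xS by (intro closest_point_in_set) auto
  have obtuse: "(a - p) \<bullet> (x - p) \<le> 0" unfolding p_def using S xS by (rule closest_point_dot)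
  have "0 \<le> \<alpha> * (d \<bullet> (p - x))" using vi[OF \<open>p \<in> S\<close>] \<open>0 \<le> \<alpha>\<close> by simp
  moreover have "(p - x) \<bullet> (a - (x - \<alpha> *\<^sub>R d)) - (p - x) \<bullet> (p - x)
      = \<alpha> * (d \<bullet> (p - x)) - (a - p) \<bullet> (x - p)"
    by (simp add: inner_diff_left inner_diff_right inner_add_right inner_commute algebra_simps)
  ultimately have "norm (p - x) * norm (p - x) \<le> (p - x) \<bullet> (a - (x - \<alpha> *\<^sub>R d))"
    using obtuse by (simp add: power2_norm_eq_inner flip: power2_eq_square)
  also have "\<dots> \<le> norm (p - x) * norm (a - (x - \<alpha> *\<^sub>R d))" by (rule norm_cauchy_schwarz)
  finally show ?thesis unfolding p_def[symmetric]
    by (cases "p = x") auto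
qed

text \<open>
  The projections act on each block separately, and so does the bound. Blocks outside \<open>I\<close> are
  frozen at \<open>0\<close>, which is how vectors over a subset of the nodes are represented.
\<close>

lemma blockwise_projected_step:
  fixes a x d :: "'a::euclidean_space^'n"
  assumes S: "\<And>i. i \<in> I \<Longrightarrow> convex (S i) \<and> closed (S i)"
    and x: "\<And>i. i \<in> I \<Longrightarrow> x $ i \<in> S i" "\<And>i. i \<notin> I \<Longrightarrow> x $ i = 0" and "0 \<le> \<alpha>"
    and vi: "\<And>i v. i \<in> I \<Longrightarrow> v \<in> S i \<Longrightarrow> 0 \<le> d $ i \<bullet> (v - x $ i)"
  shows "norm ((\<chi> i. if i \<in> I then closest_point (S i) (a $ i) else 0) - x)
    \<le> norm (a - (x - \<alpha> *\<^sub>R d))"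
proof (rule norm_le_componentwise_cart)
  fix i
  show "norm (((\<chi> i. if i \<in> I then closest_point (S i) (a $ i) else 0) - x) $ i)
      \<le> norm ((a - (x - \<alpha> *\<^sub>R d)) $ i)"
    using projected_step_towards_variational_solution[of "S i" "x $ i" \<alpha> "d $ i" "a $ i"] assms
    by (cases "i \<in> I") auto
qed

lemma norm_drift_le:
  fixes f :: "nat \<Rightarrow> 'a::real_normed_vector"
  assumes "\<And>k. norm (f (Suc k) - f k) \<le> B" and "l \<le> k"
  shows "norm (f k - f l) \<le> real (k - l) * B"
  using assms(2)
proof (induction rule: dec_induct)
  case (step n)
  have "f (Suc n) - f l = (f (Suc n) - f n) + (f n - f l)" by simp
  then have "norm (f (Suc n) - f l) \<le> norm (f (Suc n) - f n) + norm (f n - f l)"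
    by (metis norm_triangle_ineq)
  also have "\<dots> \<le> B + real (n - l) * B" using step assms(1) by (intro add_mono) auto
  finally show ?case using step by (simp add: Suc_diff_le algebra_simps)
qed simp

text \<open>
  The distance of \<open>d\<close> above the fixed point \<open>b / (1 - c)\<close> of the recursion decays geometrically.
\<close>

lemma limsup_affine_recursion_le:
  fixes d :: "nat \<Rightarrow> real"
  assumes c: "0 \<le> c" "c < 1" and rec: "\<And>k. d (Suc k) \<le> c * d k + b"
  shows "limsup (\<lambda>k. ereal (d k)) \<le> ereal (b / (1 - c))"
proof -
  define \<beta> where "\<beta> = b / (1 - c)"
  have \<beta>: "c * \<beta> + b = \<beta>" using c by (simp add: \<beta>_def field_simps)
  have bound: "d k \<le> c ^ k * (d 0 - \<beta>) + \<beta>" for k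
  proof (induction k)
    case (Suc k)
    have "d (Suc k) \<le> c * (c ^ k * (d 0 - \<beta>) + \<beta>) + b"
      using rec[of k] mult_left_mono[OF Suc c(1)] by linarith
    also have "\<dots> = c ^ Suc k * (d 0 - \<beta>) + (c * \<beta> + b)" by (simp add: algebra_simps)
    finally show ?case by (simp only: \<beta>)
  qed simp
  have "(\<lambda>k. c ^ k * (d 0 - \<beta>) + \<beta>) \<longlonglongrightarrow> 0 * (d 0 - \<beta>) + \<beta>"
    using c by (intro tendsto_intros LIMSEQ_power_zero) auto
  then have "(\<lambda>k. ereal (c ^ k * (d 0 - \<beta>) + \<beta>)) \<longlonglongrightarrow> ereal \<beta>" by simp
  from lim_imp_Limsup[OF _ this] have "limsup (\<lambda>k. ereal (c ^ k * (d 0 - \<beta>) + \<beta>)) = ereal \<beta>"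
    by simp
  then show ?thesis
    using Limsup_mono[of "\<lambda>k. ereal (d k)" "\<lambda>k. ereal (c ^ k * (d 0 - \<beta>) + \<beta>)" sequentially] bound
    by (simp add: \<beta>_def)
qed

section \<open>The voltage constraints as an affine map\<close>

text \<open>
  The sensitivity of the monitored voltages to the setpoints: the common linear part, up to sign, of
  the two constraint functions.
\<close>

definition net_map :: "('n::finite) grid \<Rightarrow> nat \<Rightarrow> (real^2)^'n \<Rightarrow> real^'n" where
  "net_map D k w = (\<Sum>i\<in>ders D. (w $ i) v* xi_mat D k i)"

definition net_adj :: "('n::finite) grid \<Rightarrow> nat \<Rightarrow> real^'n \<Rightarrow> (real^2)^'n" where
  "net_adj D k y = (\<chi> i. if i \<in> ders D then xi_mat D k i *v y else 0)"

lemma net_map_nth: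
  "net_map D k w $ n = (if n \<in> mons D
     then \<Sum>i\<in>ders D. rmat D k $ n $ i * w $ i $ 1 + bmat D k $ n $ i * w $ i $ 2 else 0)"
  by (simp add: net_map_def vector_matrix_mult_def xi_mat_def sum_2 sum_component mult.commute)

lemma linear_net_map: "linear (net_map D k)"
  by (rule linearI) (auto simp: vec_eq_iff net_map_nth sum.distrib sum_distrib_left algebra_simps)

lemma linear_net_adj: "linear (net_adj D k)"
  by (rule linearI)
    (auto simp: vec_eq_iff net_adj_def matrix_vector_right_distrib matrix_vector_mult_scaleR)

lemma net_map_adjoint: "net_map D k w \<bullet> y = w \<bullet> net_adj D k y"
  unfolding net_map_def net_adj_def inner_sum_left
  by (simp add: dot_lmul_matrix inner_vec_def[of w] if_distrib[of "inner _"] sum.If_cases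
      cong: if_cong)

lemma der_term_eq:
  assumes "n \<in> mons D"
  shows "der_term D k n w = net_map D k w $ n + der_term D k n 0"
  using assms
  by (simp add: der_term_def net_map_nth algebra_simps sum.distrib sum_subtractf sum_negf)

lemma g_low_eq: "g_low D k w = g_low D k 0 - net_map D k w"
  by (simp add: vec_eq_iff g_low_def der_term_eq[of _ D k w] net_map_nth)

lemma g_up_eq: "g_up D k w = g_up D k 0 + net_map D k w"
  by (simp add: vec_eq_iff g_up_def der_term_eq[of _ D k w] net_map_nth)

text \<open>
  The lower constraint has derivative \<open>- net_map\<close> everywhere, so a bound on one gradient norm bounds
  the linear map, and with it both gradients.
\<close>

lemma norm_net_map_le:
  assumes "onorm (frechet_derivative (g_low D k) (at 0)) \<le> G"
  shows "0 \<le> G" and "norm (net_map D k h) \<le> G * norm h"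
proof -
  have bl: "bounded_linear (net_map D k)" using linear_net_map by (simp add: linear_linear)
  have "(g_low D k has_derivative (\<lambda>h. - net_map D k h)) (at 0)"
    by (subst ext[OF g_low_eq])
      (auto intro!: derivative_eq_intros bounded_linear_imp_has_derivative[OF bl])
  then have le: "onorm (net_map D k) \<le> G"
    using assms onorm_neg[of "net_map D k"]
    by (simp add: frechet_derivative_at[symmetric] del: frechet_derivative_at)
  then show "0 \<le> G" using onorm_pos_le[OF bl] by linarith
  show "norm (net_map D k h) \<le> G * norm h"
    using le onorm[OF bl, of h] mult_right_mono[of "onorm (net_map D k)" G "norm h"] by simp
qed

text \<open>
  The square of the norm is moved through the adjunction and split by the Cauchy-Schwarz inequality.
\<close>

lemma norm_net_adj_le:
  assumes "0 \<le> G" and G: "\<And>h. norm (net_map D k h) \<le> G * norm h"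
  shows "norm (net_adj D k y) \<le> G * norm y"
proof -
  have "norm (net_adj D k y) * norm (net_adj D k y) = net_map D k (net_adj D k y) \<bullet> y"
    by (simp add: net_map_adjoint power2_norm_eq_inner flip: power2_eq_square)
  also have "\<dots> \<le> norm (net_map D k (net_adj D k y)) * norm y" by (rule norm_cauchy_schwarz)
  also have "\<dots> \<le> G * norm (net_adj D k y) * norm y" by (intro mult_right_mono G) simp
  finally have le: "norm (net_adj D k y) * norm (net_adj D k y) \<le> norm (net_adj D k y) * (G * norm y)"
    by (simp add: algebra_simps)
  show ?thesis
    using le \<open>0 \<le> G\<close> by (cases "net_adj D k y = 0") auto
qed

section \<open>Partial gradients of the regularized Lagrangian\<close>

lemma vec_upd_eq: "vec_upd x i v = x + axis i (v - x $ i)"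
  for x :: "'a::ab_group_add^'n"
  by (simp add: vec_eq_iff vec_upd_def axis_def)

text \<open>
  The Lagrangian is separable in the blocks of the setpoint, because the constraints are affine: a
  change of block \<open>i\<close> only exchanges one summand. The gradient in that block can then be read off.
\<close>

lemma lagr_vec_upd_primal:
  assumes "i \<in> ders D"
  shows "lagr D \<nu> \<epsilon> k (vec_upd w i v) \<gamma> \<mu>
    = lagr D \<nu> \<epsilon> k w \<gamma> \<mu> + (cost D k i v + v \<bullet> (xi_mat D k i *v (\<mu> - \<gamma>)) + \<nu> / 2 * (norm v)\<^sup>2)
      - (cost D k i (w $ i) + w $ i \<bullet> (xi_mat D k i *v (\<mu> - \<gamma>)) + \<nu> / 2 * (norm (w $ i))\<^sup>2)"
proof -
  have split: "(\<Sum>j\<in>ders D. F j (vec_upd w i v $ j)) = (\<Sum>j\<in>ders D. F j (w $ j)) + F i v - F i (w $ i)"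
    for F :: "'a \<Rightarrow> real^2 \<Rightarrow> real"
  proof -
    have "(\<Sum>j\<in>ders D - {i}. F j (vec_upd w i v $ j)) = (\<Sum>j\<in>ders D - {i}. F j (w $ j))"
      by (rule sum.cong) (auto simp: vec_upd_def)
    then show ?thesis using sum.remove[OF _ assms, of "\<lambda>j. F j (vec_upd w i v $ j)"]
        sum.remove[OF _ assms, of "\<lambda>j. F j (w $ j)"] by (simp add: vec_upd_def)
  qed
  have net: "net_map D k (vec_upd w i v) = net_map D k w + net_map D k (axis i (v - w $ i))"
    unfolding vec_upd_eq using linear_add[OF linear_net_map] by blast
  have "y \<bullet> net_map D k (axis i (v - w $ i)) = (v - w $ i) \<bullet> (xi_mat D k i *v y)" for y
    using assms by (simp add: inner_commute[of y] net_map_adjoint inner_axis' net_adj_def)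
  then show ?thesis
    unfolding lagr_def g_low_eq[of D k "vec_upd w i v"] g_up_eq[of D k "vec_upd w i v"]
      g_low_eq[of D k w] g_up_eq[of D k w] net
      split[of "cost D k"] split[of "\<lambda>_ x. (norm x)\<^sup>2"]
    by (simp add: algebra_simps inner_add_right inner_diff_right matrix_vector_mult_diff_distrib
        inner_diff_left)
qed

lemma GDERIV_lagr_primal:
  assumes i: "i \<in> ders D" and diff: "cost D k i differentiable (at (w $ i))"
  shows "GDERIV (\<lambda>v. lagr D \<nu> \<epsilon> k (vec_upd w i v) \<gamma> \<mu>) (w $ i)
    :> grad (cost D k i) (w $ i) + \<nu> *\<^sub>R w $ i + xi_mat D k i *v (\<mu> - \<gamma>)"
proof -
  note F = GDERIV_grad[OF diff, unfolded gderiv_def]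
  show ?thesis unfolding lagr_vec_upd_primal[OF i] gderiv_def power2_norm_eq_inner
    by (rule derivative_eq_intros F refl)+
      (auto simp: fun_eq_iff inner_add_right inner_commute algebra_simps)
qed

lemma grad_u_eq:
  assumes "i \<in> ders D" "cost D k i differentiable (at (w $ i))"
  shows "grad_u D \<nu> \<epsilon> k i w \<gamma> \<mu>
    = grad (cost D k i) (w $ i) + \<nu> *\<^sub>R w $ i + xi_mat D k i *v (\<mu> - \<gamma>)"
  unfolding grad_u_def using GDERIV_lagr_primal[OF assms] by (rule grad_eqI)

lemma inner_vec_upd:
  fixes x :: "real^'n"
  shows "vec_upd x n t \<bullet> y = x \<bullet> y + (t - x $ n) * y $ n"
  by (simp add: vec_upd_eq inner_add_left inner_axis')

lemma norm_vec_upd_sq: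
  fixes x :: "real^'n"
  shows "(norm (vec_upd x n t))\<^sup>2 = (norm x)\<^sup>2 - (x $ n)\<^sup>2 + t\<^sup>2"
proof -
  have "(norm (vec_upd x n t))\<^sup>2 = (norm x)\<^sup>2 + 2 * (x $ n * (t - x $ n)) + (t - x $ n)\<^sup>2"
    unfolding vec_upd_eq power2_norm_eq_inner
    by (simp only: inner_add_left inner_add_right inner_axis inner_axis' axis_nth inner_real_def
        power2_eq_square)
      (simp add: algebra_simps)
  then show ?thesis by (simp add: power2_eq_square algebra_simps)
qed

lemma DERIV_lagr_gamma:
  "((\<lambda>x. lagr D \<nu> \<epsilon> k w (vec_upd \<gamma> n x) \<mu>) has_real_derivative g_low D k w $ n - \<epsilon> * \<gamma> $ n)
    (at (\<gamma> $ n))"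
  unfolding lagr_def norm_vec_upd_sq inner_vec_upd
  by (auto intro!: derivative_eq_intros)

lemma DERIV_lagr_mu:
  "((\<lambda>x. lagr D \<nu> \<epsilon> k w \<gamma> (vec_upd \<mu> n x)) has_real_derivative g_up D k w $ n - \<epsilon> * \<mu> $ n)
    (at (\<mu> $ n))"
  unfolding lagr_def norm_vec_upd_sq inner_vec_upd
  by (auto intro!: derivative_eq_intros)

text \<open>
  The quantities that drive the dual updates are the dual gradients of the Lagrangian plus the
  measurement errors; this is the only way in which the voltage measurements enter the analysis.
\<close>

lemma measured_gamma_gradient:
  assumes "n \<in> mons D"
  shows "vmin D - mk $ n - \<epsilon> * \<gamma> $ n
    = (g_low D k w - \<epsilon> *\<^sub>R \<gamma> + err_gamma D \<nu> \<epsilon> k mk w \<gamma> \<mu>) $ n"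
  using assms DERIV_imp_deriv[OF DERIV_lagr_gamma, of D \<nu> \<epsilon> k w \<gamma> n \<mu>]
  by (simp add: err_gamma_def)

lemma measured_mu_gradient:
  assumes "n \<in> mons D"
  shows "mk $ n - vmax D - \<epsilon> * \<mu> $ n
    = (g_up D k w - \<epsilon> *\<^sub>R \<mu> + err_mu D \<nu> \<epsilon> k mk w \<gamma> \<mu>) $ n"
  using assms DERIV_imp_deriv[OF DERIV_lagr_mu, of D \<nu> \<epsilon> k w \<gamma> \<mu> n]
  by (simp add: err_mu_def)

section \<open>The saddle-point operator\<close>

definition cost_grad :: "('n::finite) grid \<Rightarrow> nat \<Rightarrow> (real^2)^'n \<Rightarrow> (real^2)^'n" where
  "cost_grad D k w = (\<chi> i. if i \<in> ders D then grad (cost D k i) (w $ i) else 0)"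

text \<open>
  The gradient of the Lagrangian in the setpoint and its negative gradients in the multipliers. On
  vectors supported on the DER nodes and the monitored nodes these are the components of the
  gradients used by the controllers.
\<close>

definition saddle_op :: "('n::finite) grid \<Rightarrow> real \<Rightarrow> real \<Rightarrow> nat
    \<Rightarrow> ((real^2)^'n) \<times> (real^'n) \<times> (real^'n) \<Rightarrow> ((real^2)^'n) \<times> (real^'n) \<times> (real^'n)" where
  "saddle_op D \<nu> \<epsilon> k = (\<lambda>(w, \<gamma>, \<mu>).
     (cost_grad D k w + \<nu> *\<^sub>R w + net_adj D k (\<mu> - \<gamma>),
      \<epsilon> *\<^sub>R \<gamma> - g_low D k w, \<epsilon> *\<^sub>R \<mu> - g_up D k w))"

lemma saddle_op_diff:
  "saddle_op D \<nu> \<epsilon> k (w, \<gamma>, \<mu>) - saddle_op D \<nu> \<epsilon> k (w', \<gamma>', \<mu>')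
   = (cost_grad D k w - cost_grad D k w' + \<nu> *\<^sub>R (w - w') + net_adj D k ((\<mu> - \<mu>') - (\<gamma> - \<gamma>')),
      \<epsilon> *\<^sub>R (\<gamma> - \<gamma>') + net_map D k (w - w'), \<epsilon> *\<^sub>R (\<mu> - \<mu>') - net_map D k (w - w'))"
  by (simp add: saddle_op_def g_low_eq[of D k w] g_low_eq[of D k w'] g_up_eq[of D k w]
      g_up_eq[of D k w'] linear_diff[OF linear_net_map] linear_diff[OF linear_net_adj]
      scaleR_diff_right)

text \<open>
  The cost gradients are monotone, the coupling between setpoint and multipliers is skew, and the
  regularization contributes \<open>\<nu>\<close> and \<open>\<epsilon>\<close> in the primal and dual blocks.
\<close>

lemma saddle_op_strongly_monotone:
  fixes w w' :: "(real^2)^'n"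
  assumes cv: "\<And>i. i \<in> ders D \<Longrightarrow> convex_on UNIV (cost D k i)"
    and diff: "\<And>i x. i \<in> ders D \<Longrightarrow> cost D k i differentiable (at x)"
  shows "min \<nu> \<epsilon> * (norm ((w, \<gamma>, \<mu>) - (w', \<gamma>', \<mu>')))\<^sup>2
    \<le> ((w, \<gamma>, \<mu>) - (w', \<gamma>', \<mu>'))
        \<bullet> (saddle_op D \<nu> \<epsilon> k (w, \<gamma>, \<mu>) - saddle_op D \<nu> \<epsilon> k (w', \<gamma>', \<mu>'))"
proof -
  have "0 \<le> (w $ i - w' $ i) \<bullet> (cost_grad D k w $ i - cost_grad D k w' $ i)" for i
    using convex_gradient_monotone[OF cv GDERIV_grad GDERIV_grad] diff by (simp add: cost_grad_def)
  then have mono: "0 \<le> (w - w') \<bullet> (cost_grad D k w - cost_grad D k w')"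
    by (simp add: inner_vec_def sum_nonneg)
  have "min \<nu> \<epsilon> * (norm ((w, \<gamma>, \<mu>) - (w', \<gamma>', \<mu>')))\<^sup>2
    = min \<nu> \<epsilon> * (norm (w - w'))\<^sup>2 + min \<nu> \<epsilon> * (norm (\<gamma> - \<gamma>'))\<^sup>2 + min \<nu> \<epsilon> * (norm (\<mu> - \<mu>'))\<^sup>2"
    by (simp add: norm_Pair algebra_simps)
  also have "\<dots> \<le> \<nu> * (norm (w - w'))\<^sup>2 + \<epsilon> * (norm (\<gamma> - \<gamma>'))\<^sup>2 + \<epsilon> * (norm (\<mu> - \<mu>'))\<^sup>2"
    by (intro add_mono mult_right_mono) auto
  also have "\<dots> \<le> \<dots> + (w - w') \<bullet> (cost_grad D k w - cost_grad D k w')" using mono by simp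
  (* The coupling terms cancel: the map in the dual blocks is the adjoint of the one in the
     primal block, with the opposite sign. *)
  also have "\<dots> = ((w, \<gamma>, \<mu>) - (w', \<gamma>', \<mu>'))
        \<bullet> (saddle_op D \<nu> \<epsilon> k (w, \<gamma>, \<mu>) - saddle_op D \<nu> \<epsilon> k (w', \<gamma>', \<mu>'))"
    unfolding saddle_op_diff power2_norm_eq_inner
    by (simp add: inner_add_right inner_diff_right[of _ "\<epsilon> *\<^sub>R _"] inner_commute[of _ "net_map D k _"] net_map_adjoint
        linear_diff[OF linear_net_adj] inner_diff_right)
  finally show ?thesis .
qed

text \<open>
  Each block of the difference is bounded by a multiple of the full distance \<open>d\<close>: the primal block by
  \<open>L + \<nu> + 2 G\<close>, where \<open>G\<close> is counted once per multiplier, and each dual block by \<open>G + \<epsilon>\<close>. The squares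
  of the three constants add up to that of the stated one.
\<close>

lemma saddle_op_lipschitz:
  fixes w w' :: "(real^2)^'n"
  assumes L: "norm (cost_grad D k w - cost_grad D k w') \<le> L * norm (w - w')"
    and G: "\<And>h. norm (net_map D k h) \<le> G * norm h"
    and nonneg: "0 \<le> L" "0 \<le> G" "0 \<le> \<nu>" "0 \<le> \<epsilon>"
  shows "norm (saddle_op D \<nu> \<epsilon> k (w, \<gamma>, \<mu>) - saddle_op D \<nu> \<epsilon> k (w', \<gamma>', \<mu>'))
    \<le> sqrt ((L + \<nu> + 2 * G)\<^sup>2 + 2 * (G + \<epsilon>)\<^sup>2) * norm ((w, \<gamma>, \<mu>) - (w', \<gamma>', \<mu>'))"
proof -
  define d where "d = norm ((w, \<gamma>, \<mu>) - (w', \<gamma>', \<mu>'))"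
  define p where "p = cost_grad D k w - cost_grad D k w' + \<nu> *\<^sub>R (w - w')
    + net_adj D k ((\<mu> - \<mu>') - (\<gamma> - \<gamma>'))"
  define q where "q = \<epsilon> *\<^sub>R (\<gamma> - \<gamma>') + net_map D k (w - w')"
  define r where "r = \<epsilon> *\<^sub>R (\<mu> - \<mu>') - net_map D k (w - w')"
  have dw: "norm (w - w') \<le> d" and d\<gamma>: "norm (\<gamma> - \<gamma>') \<le> d" and d\<mu>: "norm (\<mu> - \<mu>') \<le> d"
    unfolding d_def norm_Pair diff_Pair by (auto intro!: real_le_rsqrt)
  have "0 \<le> d" by (simp add: d_def)
  have net: "norm (net_map D k (w - w')) \<le> G * d"
    using G[of "w - w'"] mult_left_mono[OF dw \<open>0 \<le> G\<close>] by linarith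
  have "norm p \<le> norm (cost_grad D k w - cost_grad D k w') + norm (\<nu> *\<^sub>R (w - w'))
      + norm (net_adj D k ((\<mu> - \<mu>') - (\<gamma> - \<gamma>')))"
    unfolding p_def by (intro order_trans[OF norm_triangle_ineq] add_right_mono norm_triangle_ineq)
  also have "\<dots> \<le> L * d + \<nu> * d + G * (d + d)"
  proof (intro add_mono)
    show "norm (cost_grad D k w - cost_grad D k w') \<le> L * d"
      using L mult_left_mono[OF dw \<open>0 \<le> L\<close>] by linarith
    show "norm (\<nu> *\<^sub>R (w - w')) \<le> \<nu> * d" using nonneg dw by (simp add: mult_left_mono)
    have "norm ((\<mu> - \<mu>') - (\<gamma> - \<gamma>')) \<le> d + d"
      using norm_triangle_ineq4[of "\<mu> - \<mu>'" "\<gamma> - \<gamma>'"] d\<gamma> d\<mu> by linarith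
    then show "norm (net_adj D k ((\<mu> - \<mu>') - (\<gamma> - \<gamma>'))) \<le> G * (d + d)"
      using norm_net_adj_le[OF \<open>0 \<le> G\<close> G, of "(\<mu> - \<mu>') - (\<gamma> - \<gamma>')"] mult_left_mono[OF _ \<open>0 \<le> G\<close>]
      by (meson order_trans)
  qed
  finally have p: "norm p \<le> (L + \<nu> + 2 * G) * d" by (simp add: algebra_simps)
  have q: "norm q \<le> (G + \<epsilon>) * d"
    using norm_triangle_ineq[of "\<epsilon> *\<^sub>R (\<gamma> - \<gamma>')" "net_map D k (w - w')"] net
      mult_left_mono[OF d\<gamma> \<open>0 \<le> \<epsilon>\<close>] nonneg by (simp add: q_def distrib_right)
  have r: "norm r \<le> (G + \<epsilon>) * d"
    using norm_triangle_ineq4[of "\<epsilon> *\<^sub>R (\<mu> - \<mu>')" "net_map D k (w - w')"] net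
      mult_left_mono[OF d\<mu> \<open>0 \<le> \<epsilon>\<close>] nonneg by (simp add: r_def distrib_right)
  have "norm (p, q, r) = sqrt ((norm p)\<^sup>2 + ((norm q)\<^sup>2 + (norm r)\<^sup>2))" by (simp add: norm_Pair)
  also have "\<dots> \<le> sqrt (((L + \<nu> + 2 * G) * d)\<^sup>2 + (((G + \<epsilon>) * d)\<^sup>2 + ((G + \<epsilon>) * d)\<^sup>2))"
    by (intro real_sqrt_le_mono add_mono power_mono p q r) auto
  also have "\<dots> = sqrt (((L + \<nu> + 2 * G)\<^sup>2 + 2 * (G + \<epsilon>)\<^sup>2) * d\<^sup>2)"
    by (simp only: power_mult_distrib) (simp add: algebra_simps)
  also have "\<dots> = sqrt ((L + \<nu> + 2 * G)\<^sup>2 + 2 * (G + \<epsilon>)\<^sup>2) * d" using \<open>0 \<le> d\<close> by (simp add: real_sqrt_mult)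
  finally show ?thesis unfolding saddle_op_diff p_def q_def r_def d_def .
qed

text \<open>
  A saddle point is optimal in each single block with all others kept fixed, so each block satisfies
  its own first-order condition.
\<close>

lemma saddle_point_variational:
  assumes sp: "is_saddle_point D \<nu> \<epsilon> k (w, \<gamma>, \<mu>)"
    and diff: "\<And>i x. i \<in> ders D \<Longrightarrow> cost D k i differentiable (at x)"
    and cv: "\<And>i. i \<in> ders D \<Longrightarrow> convex (opset D k i)"
    and op: "saddle_op D \<nu> \<epsilon> k (w, \<gamma>, \<mu>) = (p, q, r)"
  shows "i \<in> ders D \<Longrightarrow> v \<in> opset D k i \<Longrightarrow> 0 \<le> p $ i \<bullet> (v - w $ i)"
    and "n \<in> mons D \<Longrightarrow> 0 \<le> x \<Longrightarrow> 0 \<le> q $ n \<bullet> (x - \<gamma> $ n)"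
    and "n \<in> mons D \<Longrightarrow> 0 \<le> x \<Longrightarrow> 0 \<le> r $ n \<bullet> (x - \<mu> $ n)"
proof -
  have w: "w \<in> primal_set D k" and duals: "\<gamma> \<in> dual_set D {0..}" "\<mu> \<in> dual_set D {0..}"
    and min: "\<And>w'. w' \<in> primal_set D k \<Longrightarrow> lagr D \<nu> \<epsilon> k w \<gamma> \<mu> \<le> lagr D \<nu> \<epsilon> k w' \<gamma> \<mu>"
    and max: "\<And>\<gamma>' \<mu>'. \<gamma>' \<in> dual_set D {0..} \<Longrightarrow> \<mu>' \<in> dual_set D {0..}
      \<Longrightarrow> lagr D \<nu> \<epsilon> k w \<gamma>' \<mu>' \<le> lagr D \<nu> \<epsilon> k w \<gamma> \<mu>"
    using sp unfolding is_saddle_point_def by auto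
  have upd: "vec_upd y j (y $ j) = y" for y :: "'b^'a" and j
    by (simp add: vec_upd_def vec_eq_iff)
  have pqr: "p = cost_grad D k w + \<nu> *\<^sub>R w + net_adj D k (\<mu> - \<gamma>)"
    "q = \<epsilon> *\<^sub>R \<gamma> - g_low D k w" "r = \<epsilon> *\<^sub>R \<mu> - g_up D k w"
    using op by (auto simp: saddle_op_def)
  show "0 \<le> p $ i \<bullet> (v - w $ i)" if i: "i \<in> ders D" and v: "v \<in> opset D k i"
  proof (rule minimum_on_convex_imp_variational[OF cv[OF i] _ v])
    show "w $ i \<in> opset D k i" using w i by (simp add: primal_set_def)
    show "GDERIV (\<lambda>v. lagr D \<nu> \<epsilon> k (vec_upd w i v) \<gamma> \<mu>) (w $ i) :> p $ i"
      using GDERIV_lagr_primal[OF i diff[OF i], where w = w and \<nu> = \<nu> and \<epsilon> = \<epsilon> and \<gamma> = \<gamma>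
          and \<mu> = \<mu>] i
      by (simp add: pqr cost_grad_def net_adj_def)
    show "lagr D \<nu> \<epsilon> k (vec_upd w i (w $ i)) \<gamma> \<mu> \<le> lagr D \<nu> \<epsilon> k (vec_upd w i y) \<gamma> \<mu>"
      if "y \<in> opset D k i" for y
      unfolding upd by (rule min) (use w i that in \<open>auto simp: primal_set_def vec_upd_def\<close>)
  qed
  show "0 \<le> q $ n \<bullet> (x - \<gamma> $ n)" if n: "n \<in> mons D" and x: "0 \<le> x"
  proof (rule minimum_on_convex_imp_variational[of "{0..}"])
    show "\<gamma> $ n \<in> {0..}" using duals n by (auto simp: dual_set_def)
    show "GDERIV (\<lambda>y. - lagr D \<nu> \<epsilon> k w (vec_upd \<gamma> n y) \<mu>) (\<gamma> $ n) :> q $ n"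
      using DERIV_minus[OF DERIV_lagr_gamma[of D \<nu> \<epsilon> k w \<gamma> n \<mu>]] by (simp add: pqr)
    show "- lagr D \<nu> \<epsilon> k w (vec_upd \<gamma> n (\<gamma> $ n)) \<mu> \<le> - lagr D \<nu> \<epsilon> k w (vec_upd \<gamma> n y) \<mu>"
      if "y \<in> {0..}" for y
      unfolding upd neg_le_iff_le
      by (rule max) (use duals n that in \<open>auto simp: dual_set_def vec_upd_def\<close>)
  qed (use x in auto)
  show "0 \<le> r $ n \<bullet> (x - \<mu> $ n)" if n: "n \<in> mons D" and x: "0 \<le> x"
  proof (rule minimum_on_convex_imp_variational[of "{0..}"])
    show "\<mu> $ n \<in> {0..}" using duals n by (auto simp: dual_set_def)
    show "GDERIV (\<lambda>y. - lagr D \<nu> \<epsilon> k w \<gamma> (vec_upd \<mu> n y)) (\<mu> $ n) :> r $ n"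
      using DERIV_minus[OF DERIV_lagr_mu[of D \<nu> \<epsilon> k w \<gamma> \<mu> n]] by (simp add: pqr)
    show "- lagr D \<nu> \<epsilon> k w \<gamma> (vec_upd \<mu> n (\<mu> $ n)) \<le> - lagr D \<nu> \<epsilon> k w \<gamma> (vec_upd \<mu> n y)"
      if "y \<in> {0..}" for y
      unfolding upd neg_le_iff_le
      by (rule max) (use duals n that in \<open>auto simp: dual_set_def vec_upd_def\<close>)
  qed (use x in auto)
qed

section \<open>Tracking the saddle-point trajectory\<close>

text \<open>
  Used to keep the multipliers in their sets and to bound how far they move in one step.
\<close>

lemma dual_update:
  assumes S: "convex S" "closed S" and y: "y \<in> dual_set D S" and "0 \<le> \<alpha>"
    and y': "y' = (\<chi> n. if n \<in> mons D then closest_point S (y $ n + \<alpha> * h $ n) else 0)"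
  shows "y' \<in> dual_set D S" and "norm (y' - y) \<le> \<alpha> * norm h"
proof -
  show "y' \<in> dual_set D S"
    using closest_point_in_set[OF S(2)] y by (auto simp: y' dual_set_def)
  (* The current point y solves the trivial variational inequality d = 0. *)
  have "norm (y' - y) \<le> norm ((y + \<alpha> *\<^sub>R h) - (y - \<alpha> *\<^sub>R 0))"
    using blockwise_projected_step[of "mons D" "\<lambda>_. S" y \<alpha> 0 "y + \<alpha> *\<^sub>R h"] S y \<open>0 \<le> \<alpha>\<close>
    by (simp add: y' dual_set_def cong: if_cong)
  then show "norm (y' - y) \<le> \<alpha> * norm h" using \<open>0 \<le> \<alpha>\<close> by simp
qed

lemma norm_Pair_mono:
  "norm a \<le> norm a' \<Longrightarrow> norm b \<le> norm b' \<Longrightarrow> norm (a, b) \<le> norm (a', b')"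
  by (simp add: norm_Pair add_mono power_mono)

text \<open>
  The multipliers are projected onto subsets of the half-line. The saddle point lies in these
  subsets, so its first-order conditions, which hold over the whole half-line, apply there as well.
\<close>

lemma projected_step_towards_saddle_point:
  assumes sp: "is_saddle_point D \<nu> \<epsilon> k (ws, \<gamma>s, \<mu>s)"
    and diff: "\<And>i x. i \<in> ders D \<Longrightarrow> cost D k i differentiable (at x)"
    and op: "\<And>i. i \<in> ders D \<Longrightarrow> convex (opset D k i) \<and> closed (opset D k i)"
    and S\<gamma>: "convex S\<gamma>" "closed S\<gamma>" "S\<gamma> \<subseteq> {0..}" "\<gamma>s \<in> dual_set D S\<gamma>"
    and S\<mu>: "convex S\<mu>" "closed S\<mu>" "S\<mu> \<subseteq> {0..}" "\<mu>s \<in> dual_set D S\<mu>"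
    and "0 \<le> \<alpha>"
  shows "norm ((\<chi> i. if i \<in> ders D then closest_point (opset D k i) (a $ i) else 0,
      \<chi> n. if n \<in> mons D then closest_point S\<gamma> (b $ n) else 0,
      \<chi> n. if n \<in> mons D then closest_point S\<mu> (c $ n) else 0) - (ws, \<gamma>s, \<mu>s))
    \<le> norm ((a, b, c) - ((ws, \<gamma>s, \<mu>s) - \<alpha> *\<^sub>R saddle_op D \<nu> \<epsilon> k (ws, \<gamma>s, \<mu>s)))"
proof -
  obtain p q r where pqr: "saddle_op D \<nu> \<epsilon> k (ws, \<gamma>s, \<mu>s) = (p, q, r)" by (metis prod_cases3)
  note vi = saddle_point_variational[OF sp diff _ pqr]
  have ws: "ws \<in> primal_set D k" using sp by (simp add: is_saddle_point_def)
  show ?thesis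
    unfolding pqr diff_Pair scaleR_Pair
  proof (intro norm_Pair_mono blockwise_projected_step)
    show "0 \<le> p $ i \<bullet> (v - ws $ i)" if "i \<in> ders D" "v \<in> opset D k i" for i v
      using vi(1) that op by blast
    show "0 \<le> q $ n \<bullet> (x - \<gamma>s $ n)" if "n \<in> mons D" "x \<in> S\<gamma>" for n x
      using vi(2) that op S\<gamma>(3) by fastforce
    show "0 \<le> r $ n \<bullet> (x - \<mu>s $ n)" if "n \<in> mons D" "x \<in> S\<mu>" for n x
      using vi(3) that op S\<mu>(3) by fastforce
  qed (use assms ws in \<open>auto simp: primal_set_def dual_set_def\<close>)
qed

text \<open>
  The difference of the primal gradients at current and at outdated multipliers. The multiplier
  \<open>\<mu> - \<gamma>\<close> has drifted by at most \<open>\<alpha> (a + b)\<close> in each of the at most \<open>E i\<close> missed rounds, and \<open>X i\<close> is the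
  norm of its influence on DER \<open>i\<close>.
\<close>

lemma delayed_dual_gradient_error:
  fixes \<gamma> \<mu> :: "nat \<Rightarrow> real^'n"
  assumes "0 \<le> \<alpha>"
    and drift: "\<And>k. norm (\<gamma> (Suc k) - \<gamma> k) \<le> \<alpha> * a" "\<And>k. norm (\<mu> (Suc k) - \<mu> k) \<le> \<alpha> * b"
    and l: "\<And>i. i \<in> ders D \<Longrightarrow> l i \<le> k" "\<And>i. i \<in> ders D \<Longrightarrow> k - l i \<le> E i"
    and X: "\<And>i. i \<in> ders D \<Longrightarrow> onorm (\<lambda>y. xi_mat D k i *v y) \<le> X i"
  shows "norm (\<chi> i. if i \<in> ders D
      then xi_mat D k i *v ((\<mu> k - \<gamma> k) - (\<mu> (l i) - \<gamma> (l i))) else 0)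
    \<le> \<alpha> * sqrt (\<Sum>i\<in>ders D. (real (E i))\<^sup>2 * (X i)\<^sup>2 * (a + b)\<^sup>2)" (is "norm ?e \<le> _")
proof -
  have ab: "0 \<le> \<alpha> * a" "0 \<le> \<alpha> * b" using drift norm_ge_zero order_trans by blast+
  have comp: "(norm (?e $ i))\<^sup>2 \<le> \<alpha>\<^sup>2 * ((real (E i))\<^sup>2 * (X i)\<^sup>2 * (a + b)\<^sup>2)" if i: "i \<in> ders D" for i
  proof -
    let ?\<delta> = "(\<mu> k - \<gamma> k) - (\<mu> (l i) - \<gamma> (l i))"
    have bl: "bounded_linear (\<lambda>y. xi_mat D k i *v y)" by (rule matrix_vector_mul_bounded_linear)
    have "0 \<le> X i" using onorm_pos_le[OF bl] X[OF i] by linarith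
    have "?\<delta> = (\<mu> k - \<mu> (l i)) - (\<gamma> k - \<gamma> (l i))" by simp
    then have "norm ?\<delta> \<le> norm (\<mu> k - \<mu> (l i)) + norm (\<gamma> k - \<gamma> (l i))"
      by (metis norm_triangle_ineq4)
    also have "\<dots> \<le> real (k - l i) * (\<alpha> * b) + real (k - l i) * (\<alpha> * a)"
      by (intro add_mono norm_drift_le drift l i)
    also have "\<dots> \<le> real (E i) * (\<alpha> * b) + real (E i) * (\<alpha> * a)"
      using l(2)[OF i] ab by (intro add_mono mult_right_mono) auto
    finally have \<delta>: "norm ?\<delta> \<le> real (E i) * (\<alpha> * (a + b))" by (simp add: algebra_simps)
    have "norm (?e $ i) \<le> onorm (\<lambda>y. xi_mat D k i *v y) * norm ?\<delta>"
      using onorm[OF bl, of ?\<delta>] i by simp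
    also have "\<dots> \<le> X i * (real (E i) * (\<alpha> * (a + b)))"
      using X[OF i] \<delta> \<open>0 \<le> X i\<close> by (intro mult_mono) auto
    finally have "(norm (?e $ i))\<^sup>2 \<le> (X i * (real (E i) * (\<alpha> * (a + b))))\<^sup>2"
      by (intro power_mono) auto
    then show ?thesis by (simp only: power_mult_distrib mult.assoc mult.commute mult.left_commute)
  qed
  have "(norm ?e)\<^sup>2 = (\<Sum>i\<in>UNIV. (norm (?e $ i))\<^sup>2)"
    by (simp add: norm_vec_def L2_set_def sum_nonneg)
  also have "\<dots> = (\<Sum>i\<in>ders D. (norm (?e $ i))\<^sup>2)" by (rule sum.mono_neutral_right) auto
  also have "\<dots> \<le> (\<Sum>i\<in>ders D. \<alpha>\<^sup>2 * ((real (E i))\<^sup>2 * (X i)\<^sup>2 * (a + b)\<^sup>2))"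
    by (intro sum_mono comp)
  also have "\<dots> = \<alpha>\<^sup>2 * (\<Sum>i\<in>ders D. (real (E i))\<^sup>2 * (X i)\<^sup>2 * (a + b)\<^sup>2)"
    by (simp add: sum_distrib_left)
  finally have "norm ?e \<le> sqrt \<dots>" by (rule real_le_rsqrt)
  then show ?thesis using \<open>0 \<le> \<alpha>\<close> by (simp add: real_sqrt_mult)
qed

theorem theorem1:
  fixes D :: "('n::finite) grid"
    and \<nu> \<epsilon> \<alpha> :: real
    and us :: "nat \<Rightarrow> (real^2)^'n" and \<gamma>s \<mu>s :: "nat \<Rightarrow> real^'n"
    and S\<gamma> S\<mu> :: "real set"
    and m :: "nat \<Rightarrow> real^'n" and ell :: "'n \<Rightarrow> nat \<Rightarrow> nat"
    and u :: "nat \<Rightarrow> (real^2)^'n" and \<gamma> \<mu> :: "nat \<Rightarrow> real^'n"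
    and L G K Kbar D\<gamma> D\<mu> e\<^sub>d \<sigma>\<^sub>u \<sigma>\<^sub>d \<sigma>\<^sub>d\<^sub>b\<^sub>a\<^sub>r \<sigma>\<^sub>z :: real
    and E :: "'n \<Rightarrow> nat" and X :: "'n \<Rightarrow> real"
    and \<eta> L\<nu>\<epsilon> \<rho> e\<^sub>u e :: real
  assumes pos: "\<nu> > 0" "\<epsilon> > 0" "\<alpha> > 0"
    and opset: "\<And>k i. i \<in> ders D \<Longrightarrow>
      opset D k i \<noteq> {} \<and> convex (opset D k i) \<and> compact (opset D k i)"
    and saddle: "\<And>k. is_saddle_point D \<nu> \<epsilon> k (us k, \<gamma>s k, \<mu>s k)"
    and dual_sets: "compact S\<gamma>" "convex S\<gamma>" "S\<gamma> \<subseteq> {0..}" "compact S\<mu>" "convex S\<mu>" "S\<mu> \<subseteq> {0..}"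
      "\<And>k. \<gamma>s k \<in> dual_set D S\<gamma>" "\<And>k. \<mu>s k \<in> dual_set D S\<mu>"
    and run: "controller_run D \<nu> \<epsilon> \<alpha> S\<gamma> S\<mu> m ell u \<gamma> \<mu>"
    and A1: "\<And>k i. i \<in> ders D \<Longrightarrow> convex_on UNIV (cost D k i)"
      "\<And>k i x. i \<in> ders D \<Longrightarrow> cost D k i differentiable (at x)"
      "\<And>k i. i \<in> ders D \<Longrightarrow> continuous_on UNIV (grad (cost D k i))"
      "\<And>k. L-lipschitz_on (lipschitz_dom D k)
             (\<lambda>w. \<chi> i. if i \<in> ders D then grad (cost D k i) (w $ i) else 0)"
    and A2: "\<And>k. \<exists>w\<in>primal_set D k. \<forall>n\<in>mons D. g_low D k w $ n \<le> 0 \<and> g_up D k w $ n \<le> 0"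
    and A3: "\<sigma>\<^sub>u \<ge> 0" "\<And>k. norm (us (Suc k) - us k) \<le> \<sigma>\<^sub>u"
    and A4: "\<sigma>\<^sub>d \<ge> 0" "\<sigma>\<^sub>d\<^sub>b\<^sub>a\<^sub>r \<ge> 0"
      "\<And>k n. n \<in> mons D \<Longrightarrow>
         \<bar>g_low D (Suc k) (us (Suc k)) $ n - g_low D k (us k) $ n\<bar> \<le> \<sigma>\<^sub>d"
      "\<And>k n. n \<in> mons D \<Longrightarrow>
         \<bar>g_up D (Suc k) (us (Suc k)) $ n - g_up D k (us k) $ n\<bar> \<le> \<sigma>\<^sub>d\<^sub>b\<^sub>a\<^sub>r"
    and A5: "e\<^sub>d \<ge> 0"
      "\<And>k. max (norm (err_gamma D \<nu> \<epsilon> k (m k) (u k) (\<gamma> k) (\<mu> k)))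
                (norm (err_mu D \<nu> \<epsilon> k (m k) (u k) (\<gamma> k) (\<mu> k))) \<le> e\<^sub>d"
    and A6: "\<And>k i. i \<in> ders D \<Longrightarrow> k - ell i k \<le> E i"
    and G: "\<And>k w. onorm (frechet_derivative (g_low D k) (at w)) \<le> G"
      "\<And>k w. onorm (frechet_derivative (g_up D k) (at w)) \<le> G"
    and K: "\<And>k w. w \<in> (\<Union>j. primal_set D j) \<Longrightarrow> norm (g_low D k w) \<le> K"
      "\<And>k w. w \<in> (\<Union>j. primal_set D j) \<Longrightarrow> norm (g_up D k w) \<le> Kbar"
    and D\<gamma>: "D\<gamma> > 0" "\<And>y. y \<in> dual_set D S\<gamma> \<Longrightarrow> norm y \<le> D\<gamma>"
    and D\<mu>: "D\<mu> > 0" "\<And>y. y \<in> dual_set D S\<mu> \<Longrightarrow> norm y \<le> D\<mu>"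
    and X: "\<And>k i. i \<in> ders D \<Longrightarrow> onorm (\<lambda>y. xi_mat D k i *v y) \<le> X i"
    and \<sigma>z: "\<sigma>\<^sub>z \<ge> 0"
      "\<And>k. norm ((us (Suc k), \<gamma>s (Suc k), \<mu>s (Suc k)) - (us k, \<gamma>s k, \<mu>s k)) \<le> \<sigma>\<^sub>z"
    and \<eta>_def: "\<eta> = min \<nu> \<epsilon>"
    and L\<nu>\<epsilon>_def: "L\<nu>\<epsilon> = sqrt ((L + \<nu> + 2 * G)\<^sup>2 + 2 * (G + \<epsilon>)\<^sup>2)"
    and \<rho>_def: "\<rho> = sqrt (1 - 2 * \<eta> * \<alpha> + \<alpha>\<^sup>2 * L\<nu>\<epsilon>\<^sup>2)"
    and e\<^sub>u_def: "e\<^sub>u = \<alpha> * sqrt (\<Sum>i\<in>ders D. (real (E i))\<^sup>2 * (X i)\<^sup>2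
                         * (K + Kbar + \<epsilon> * (D\<gamma> + D\<mu>) + 2 * e\<^sub>d)\<^sup>2)"
    and e_def: "e = sqrt (e\<^sub>u\<^sup>2 + 2 * e\<^sub>d\<^sup>2)"
  shows "(\<rho> < 1 \<longleftrightarrow> \<alpha> < 2 * \<eta> / L\<nu>\<epsilon>\<^sup>2) \<and>
    (\<rho> < 1 \<longrightarrow>
       q_linear_upto (\<lambda>k. norm ((u k, \<gamma> k, \<mu> k) - (us k, \<gamma>s k, \<mu>s k)))
         (1 / (1 - \<rho>) * (\<alpha> * e + \<sigma>\<^sub>z)) \<and>
       limsup (\<lambda>k. ereal (norm ((u k, \<gamma> k, \<mu> k) - (us k, \<gamma>s k, \<mu>s k))))
         \<le> ereal (1 / (1 - \<rho>) * (\<alpha> * e + \<sigma>\<^sub>z)))"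
proof -
  have u0: "u 0 \<in> primal_set D 0" and \<gamma>0: "\<gamma> 0 \<in> dual_set D S\<gamma>" and \<mu>0: "\<mu> 0 \<in> dual_set D S\<mu>"
    and u_step: "\<And>k. u (Suc k) = (\<chi> i. if i \<in> ders D then closest_point (opset D k i)
      (u k $ i - \<alpha> *\<^sub>R grad_u D \<nu> \<epsilon> k i (u k) (\<gamma> (ell i k)) (\<mu> (ell i k))) else 0)"
    and \<gamma>_step: "\<And>k. \<gamma> (Suc k) = (\<chi> n. if n \<in> mons D
      then closest_point S\<gamma> (\<gamma> k $ n + \<alpha> * (vmin D - m k $ n - \<epsilon> * \<gamma> k $ n)) else 0)"
    and \<mu>_step: "\<And>k. \<mu> (Suc k) = (\<chi> n. if n \<in> mons D
      then closest_point S\<mu> (\<mu> k $ n + \<alpha> * (m k $ n - vmax D - \<epsilon> * \<mu> k $ n)) else 0)"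
    and ell: "\<And>i k. i \<in> ders D \<Longrightarrow> ell i k \<le> k"
    using run by (auto simp: controller_run_def)
  have op: "convex (opset D k i) \<and> closed (opset D k i)" if "i \<in> ders D" for k i
    using opset[OF that] compact_imp_closed by blast
  have S_closed: "closed S\<gamma>" "closed S\<mu>" using dual_sets(1,4) by (simp_all add: compact_imp_closed)

  (* Measurement errors and the measured dual gradients that drive the dual updates. *)
  define e\<gamma> where "e\<gamma> k = err_gamma D \<nu> \<epsilon> k (m k) (u k) (\<gamma> k) (\<mu> k)" for k
  define e\<mu> where "e\<mu> k = err_mu D \<nu> \<epsilon> k (m k) (u k) (\<gamma> k) (\<mu> k)" for k
  have err: "norm (e\<gamma> k) \<le> e\<^sub>d" "norm (e\<mu> k) \<le> e\<^sub>d" for k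
    using A5(2)[of k] by (auto simp: e\<gamma>_def e\<mu>_def)
  define h\<gamma> where "h\<gamma> k = g_low D k (u k) - \<epsilon> *\<^sub>R \<gamma> k + e\<gamma> k" for k
  define h\<mu> where "h\<mu> k = g_up D k (u k) - \<epsilon> *\<^sub>R \<mu> k + e\<mu> k" for k
  have h\<gamma>_nth: "vmin D - m k $ n - \<epsilon> * \<gamma> k $ n = h\<gamma> k $ n" if "n \<in> mons D" for k n
    unfolding h\<gamma>_def e\<gamma>_def by (rule measured_gamma_gradient[OF that])
  have h\<mu>_nth: "m k $ n - vmax D - \<epsilon> * \<mu> k $ n = h\<mu> k $ n" if "n \<in> mons D" for k n
    unfolding h\<mu>_def e\<mu>_def by (rule measured_mu_gradient[OF that])
  have \<gamma>_step': "\<gamma> (Suc k) = (\<chi> n. if n \<in> mons D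
      then closest_point S\<gamma> (\<gamma> k $ n + \<alpha> * h\<gamma> k $ n) else 0)" for k
    unfolding \<gamma>_step by (simp only: h\<gamma>_nth cong: if_cong)
  have \<mu>_step': "\<mu> (Suc k) = (\<chi> n. if n \<in> mons D
      then closest_point S\<mu> (\<mu> k $ n + \<alpha> * h\<mu> k $ n) else 0)" for k
    unfolding \<mu>_step by (simp only: h\<mu>_nth cong: if_cong)

  have u_Suc: "u (Suc k) \<in> primal_set D k" for k
    unfolding u_step primal_set_def by (simp add: closest_point_in_set op opset)
  (* u (Suc k) is projected onto the feasible set of time k; this is why the Lipschitz domain
     at each time contains the feasible set of the time before. *)
  have u_dom: "u k \<in> lipschitz_dom D k" and u_mem: "u k \<in> (\<Union>j. primal_set D j)" for k
    using u0 u_Suc by (cases k; auto simp: lipschitz_dom_def)+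
  have \<gamma>_mem: "\<gamma> k \<in> dual_set D S\<gamma>" for k
    by (induction k) (use \<gamma>0 dual_update(1)[OF dual_sets(2) S_closed(1) _ _ \<gamma>_step'] pos in auto)
  have \<mu>_mem: "\<mu> k \<in> dual_set D S\<mu>" for k
    by (induction k) (use \<mu>0 dual_update(1)[OF dual_sets(5) S_closed(2) _ _ \<mu>_step'] pos in auto)

  have drift\<gamma>: "norm (\<gamma> (Suc k) - \<gamma> k) \<le> \<alpha> * (K + \<epsilon> * D\<gamma> + e\<^sub>d)" for k
  proof -
    have "norm (h\<gamma> k) \<le> norm (g_low D k (u k)) + norm (\<epsilon> *\<^sub>R \<gamma> k) + norm (e\<gamma> k)"
      unfolding h\<gamma>_def by (intro order_trans[OF norm_triangle_ineq] add_right_mono norm_triangle_ineq4)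
    also have "\<dots> \<le> K + \<epsilon> * D\<gamma> + e\<^sub>d"
      using K(1)[OF u_mem] D\<gamma>(2)[OF \<gamma>_mem] err(1) pos by (intro add_mono) auto
    finally show ?thesis
      using dual_update(2)[OF dual_sets(2) S_closed(1) \<gamma>_mem _ \<gamma>_step'] pos
      by (meson less_imp_le mult_left_mono order_trans)
  qed
  have drift\<mu>: "norm (\<mu> (Suc k) - \<mu> k) \<le> \<alpha> * (Kbar + \<epsilon> * D\<mu> + e\<^sub>d)" for k
  proof -
    have "norm (h\<mu> k) \<le> norm (g_up D k (u k)) + norm (\<epsilon> *\<^sub>R \<mu> k) + norm (e\<mu> k)"
      unfolding h\<mu>_def by (intro order_trans[OF norm_triangle_ineq] add_right_mono norm_triangle_ineq4)
    also have "\<dots> \<le> Kbar + \<epsilon> * D\<mu> + e\<^sub>d"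
      using K(2)[OF u_mem] D\<mu>(2)[OF \<mu>_mem] err(2) pos by (intro add_mono) auto
    finally show ?thesis
      using dual_update(2)[OF dual_sets(5) S_closed(2) \<mu>_mem _ \<mu>_step'] pos
      by (meson less_imp_le mult_left_mono order_trans)
  qed

  (* The error in the primal gradient caused by lost packets. *)
  define eu where "eu k = (\<chi> i. if i \<in> ders D
    then xi_mat D k i *v ((\<mu> k - \<gamma> k) - (\<mu> (ell i k) - \<gamma> (ell i k))) else 0)" for k
  have eu: "norm (eu k) \<le> e\<^sub>u" for k
  proof -
    have total: "K + Kbar + \<epsilon> * (D\<gamma> + D\<mu>) + 2 * e\<^sub>d
        = (K + \<epsilon> * D\<gamma> + e\<^sub>d) + (Kbar + \<epsilon> * D\<mu> + e\<^sub>d)"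
      by (simp add: algebra_simps)
    show ?thesis
      unfolding e\<^sub>u_def eu_def total
      by (rule delayed_dual_gradient_error)
        (use pos ell A6 X drift\<gamma> drift\<mu> in \<open>auto intro: less_imp_le\<close>)
  qed
  have err_total: "norm (eu k, e\<gamma> k, e\<mu> k) \<le> e" for k
  proof -
    have "norm (eu k, e\<gamma> k, e\<mu> k) = sqrt ((norm (eu k))\<^sup>2 + ((norm (e\<gamma> k))\<^sup>2 + (norm (e\<mu> k))\<^sup>2))"
      by (simp add: norm_Pair)
    also have "\<dots> \<le> sqrt (e\<^sub>u\<^sup>2 + (e\<^sub>d\<^sup>2 + e\<^sub>d\<^sup>2))"
      by (intro real_sqrt_le_mono add_mono power_mono eu err) auto
    finally show ?thesis by (simp add: e_def)
  qed

  define z where "z k = (u k, \<gamma> k, \<mu> k)" for k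
  define zs where "zs k = (us k, \<gamma>s k, \<mu>s k)" for k
  define \<Phi> where "\<Phi> k = saddle_op D \<nu> \<epsilon> k" for k
  have L_nonneg: "0 \<le> L" using lipschitz_on_nonneg[OF A1(4)] .
  note G_nonneg = norm_net_map_le(1)[OF G(1)]
  have step: "norm (z (Suc k) - zs k) \<le> \<rho> * norm (z k - zs k) + \<alpha> * e" for k
  proof -
    (* The controllers project a perturbed forward step of the saddle-point operator. *)
    define x where "x = z k - \<alpha> *\<^sub>R \<Phi> k (z k) + \<alpha> *\<^sub>R (eu k, e\<gamma> k, e\<mu> k)"
    obtain a b c where abc: "x = (a, b, c)" by (metis prod_cases3)
    have a_eq: "a = u k - \<alpha> *\<^sub>R (cost_grad D k (u k) + \<nu> *\<^sub>R u k + net_adj D k (\<mu> k - \<gamma> k))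
        + \<alpha> *\<^sub>R eu k"
      using abc by (simp add: x_def z_def \<Phi>_def saddle_op_def)
    have a: "a $ i = u k $ i - \<alpha> *\<^sub>R grad_u D \<nu> \<epsilon> k i (u k) (\<gamma> (ell i k)) (\<mu> (ell i k))"
      if "i \<in> ders D" for i
      unfolding a_eq using that by (simp add: grad_u_eq[OF that A1(2)[OF that]] eu_def cost_grad_def net_adj_def
          matrix_vector_mult_diff_distrib algebra_simps)
    have b: "b = \<gamma> k + \<alpha> *\<^sub>R h\<gamma> k" and c: "c = \<mu> k + \<alpha> *\<^sub>R h\<mu> k"
      using abc by (auto simp: x_def z_def \<Phi>_def saddle_op_def h\<gamma>_def h\<mu>_def algebra_simps)
    have "z (Suc k) = (\<chi> i. if i \<in> ders D then closest_point (opset D k i) (a $ i) else 0,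
      \<chi> n. if n \<in> mons D then closest_point S\<gamma> (b $ n) else 0,
      \<chi> n. if n \<in> mons D then closest_point S\<mu> (c $ n) else 0)"
      by (simp add: z_def u_step \<gamma>_step' \<mu>_step' b c vec_eq_iff a)
    then have "norm (z (Suc k) - zs k) \<le> norm (x - (zs k - \<alpha> *\<^sub>R \<Phi> k (zs k)))"
      unfolding zs_def \<Phi>_def abc
      using projected_step_towards_saddle_point[where \<alpha> = \<alpha> and a = a and b = b and c = c,
          OF saddle A1(2) op dual_sets(2) S_closed(1) dual_sets(3,7,5) S_closed(2) dual_sets(6,8)]
        pos by simp
    also have "x - (zs k - \<alpha> *\<^sub>R \<Phi> k (zs k))
        = ((z k - zs k) - \<alpha> *\<^sub>R (\<Phi> k (z k) - \<Phi> k (zs k))) + \<alpha> *\<^sub>R (eu k, e\<gamma> k, e\<mu> k)"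
      unfolding x_def by (simp only: scaleR_diff_right) simp
    also have "norm \<dots> \<le> norm ((z k - zs k) - \<alpha> *\<^sub>R (\<Phi> k (z k) - \<Phi> k (zs k)))
        + norm (\<alpha> *\<^sub>R (eu k, e\<gamma> k, e\<mu> k))" by (rule norm_triangle_ineq)
    also have "\<dots> \<le> \<rho> * norm (z k - zs k) + \<alpha> * e"
    proof (rule add_mono)
      show "norm ((z k - zs k) - \<alpha> *\<^sub>R (\<Phi> k (z k) - \<Phi> k (zs k))) \<le> \<rho> * norm (z k - zs k)"
        unfolding \<rho>_def
      proof (rule forward_step_contraction)
        show "\<eta> * (norm (z k - zs k))\<^sup>2 \<le> (z k - zs k) \<bullet> (\<Phi> k (z k) - \<Phi> k (zs k))"
          unfolding \<eta>_def z_def zs_def \<Phi>_def using A1(1,2) by (rule saddle_op_strongly_monotone)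
        have "us k \<in> lipschitz_dom D k"
          using saddle[of k] by (simp add: is_saddle_point_def lipschitz_dom_def)
        then have "norm (cost_grad D k (u k) - cost_grad D k (us k)) \<le> L * norm (u k - us k)"
          using lipschitz_onD[OF A1(4) u_dom] by (simp add: dist_norm cost_grad_def)
        then show "norm (\<Phi> k (z k) - \<Phi> k (zs k)) \<le> L\<nu>\<epsilon> * norm (z k - zs k)"
          unfolding L\<nu>\<epsilon>_def z_def zs_def \<Phi>_def
          by (rule saddle_op_lipschitz)
            (use norm_net_map_le(2)[OF G(1)] L_nonneg G_nonneg pos in \<open>auto intro: less_imp_le\<close>)
      qed (use pos in simp)
      show "norm (\<alpha> *\<^sub>R (eu k, e\<gamma> k, e\<mu> k)) \<le> \<alpha> * e"
        unfolding norm_scaleR using err_total pos by simp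
    qed
    finally show ?thesis .
  qed
  have rec: "norm (z (Suc k) - zs (Suc k)) \<le> \<rho> * norm (z k - zs k) + (\<alpha> * e + \<sigma>\<^sub>z)" for k
    using norm_triangle_ineq4[of "z (Suc k) - zs k" "zs (Suc k) - zs k"] step[of k] \<sigma>z(2)[of k]
    by (simp add: zs_def[symmetric])

  have L_sq: "L\<nu>\<epsilon>\<^sup>2 = (L + \<nu> + 2 * G)\<^sup>2 + 2 * (G + \<epsilon>)\<^sup>2" by (simp add: L\<nu>\<epsilon>_def)
  (* The radicand of \<rho> is nonnegative since L\<nu>\<epsilon> dominates \<nu>, hence \<eta>. *)
  have "\<nu>\<^sup>2 \<le> (L + \<nu> + 2 * G)\<^sup>2" using L_nonneg G_nonneg pos by (intro power_mono) auto
  then have L_ge: "\<nu>\<^sup>2 \<le> L\<nu>\<epsilon>\<^sup>2" unfolding L_sq by (simp add: add_increasing2)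
  have "\<eta>\<^sup>2 \<le> \<nu>\<^sup>2" using pos by (intro power_mono) (auto simp: \<eta>_def)
  then have "0 \<le> (1 - \<eta> * \<alpha>)\<^sup>2 + \<alpha>\<^sup>2 * (L\<nu>\<epsilon>\<^sup>2 - \<eta>\<^sup>2)" using L_ge by simp
  then have "0 \<le> 1 - 2 * \<eta> * \<alpha> + \<alpha>\<^sup>2 * L\<nu>\<epsilon>\<^sup>2" by (simp add: power2_eq_square algebra_simps)
  then have \<rho>_nonneg: "0 \<le> \<rho>" by (simp add: \<rho>_def)
  have L_pos: "0 < L\<nu>\<epsilon>\<^sup>2" using L_ge pos by (meson less_le_trans zero_less_power)
  have "\<rho> < 1 \<longleftrightarrow> \<alpha> * (\<alpha> * L\<nu>\<epsilon>\<^sup>2) < \<alpha> * (2 * \<eta>)"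
    by (simp add: \<rho>_def power2_eq_square algebra_simps)
  also have "\<dots> \<longleftrightarrow> \<alpha> < 2 * \<eta> / L\<nu>\<epsilon>\<^sup>2" using pos L_pos by (simp add: pos_less_divide_eq)
  finally have stepsize: "\<rho> < 1 \<longleftrightarrow> \<alpha> < 2 * \<eta> / L\<nu>\<epsilon>\<^sup>2" .

  have "0 \<le> \<alpha> * e + \<sigma>\<^sub>z" using pos \<sigma>z(1) by (simp add: e_def)
  then have "q_linear_upto (\<lambda>k. norm (z k - zs k)) (1 / (1 - \<rho>) * (\<alpha> * e + \<sigma>\<^sub>z))" if "\<rho> < 1"
    unfolding q_linear_upto_def using \<rho>_nonneg that rec
    by (intro exI[of _ \<rho>] exI[of _ "\<alpha> * e + \<sigma>\<^sub>z"]) auto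
  moreover have "limsup (\<lambda>k. ereal (norm (z k - zs k))) \<le> ereal (1 / (1 - \<rho>) * (\<alpha> * e + \<sigma>\<^sub>z))"
    if "\<rho> < 1"
    using limsup_affine_recursion_le[where d = "\<lambda>k. norm (z k - zs k)", OF \<rho>_nonneg that rec] by simp
  ultimately show ?thesis using stepsize unfolding z_def zs_def by blast
qed

end
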